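(* Let $\varphi$ be a nondecreasing function defined on $(0,\infty)$ such that $t\mapsto\varphi(e^t)$ is convex on $\mathbb{R}$. Let $A_1,\ldots,A_m\in\mathbb{P}_n$ and let $X_1,\ldots,X_m\in\mathbb{M}_n$ be invertible. Then the map $$(t_1,\ldots,t_m)\mapsto \mathrm{Tr}\,\varphi\Big(\sum_{i=1}^m X_i^*A_i^{t_i}X_i\Big)$$ is jointly convex on $\mathbb{R}^m$.
   Context: $\mathbb{M}_n$ denotes the space of $n\times n$ complex matrices and $\mathbb{P}_n$ the cone of positive definite matrices in $\mathbb{M}_n$. For $A\in\mathbb{P}_n$ and $t\in\mathbb{R}$, $A^t$ is defined by functional calculus, and for a Hermitian positive definite matrix $H$, $\varphi(H)$ is defined by functional calculus. $\mathrm{Tr}$ is the trace. *)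

theory Defs
  imports "HOL-Analysis.Analysis" "Jordan_Normal_Form.Schur_Decomposition"
begin

definition hermitian_mat :: "complex mat \<Rightarrow> bool" where
  "hermitian_mat H \<longleftrightarrow> H \<in> carrier_mat (dim_row H) (dim_row H) \<and> mat_adjoint H = H"

definition unitary_mat :: "complex mat \<Rightarrow> bool" where
  "unitary_mat U \<longleftrightarrow> U \<in> carrier_mat (dim_row U) (dim_row U)
      \<and> mat_adjoint U * U = 1\<^sub>m (dim_row U)"

definition posdef_mat :: "nat \<Rightarrow> complex mat \<Rightarrow> bool" where
  "posdef_mat n A \<longleftrightarrow> A \<in> carrier_mat n n \<and> hermitian_mat A \<and>
      (\<forall>x \<in> carrier_vec n. x \<noteq> 0\<^sub>v n \<longrightarrow> 0 < Re ((A *\<^sub>v x) \<bullet>c x))"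

definition real_diag_mat :: "nat \<Rightarrow> (nat \<Rightarrow> real) \<Rightarrow> complex mat" where
  "real_diag_mat n d = mat n n (\<lambda>(i,j). if i = j then complex_of_real (d i) else 0)"

definition mat_fun :: "(real \<Rightarrow> real) \<Rightarrow> complex mat \<Rightarrow> complex mat" where
  "mat_fun f H = (let n = dim_row H;
      (U, d) = (SOME (U, d). U \<in> carrier_mat n n \<and> unitary_mat U \<and>
                    H = U * real_diag_mat n d * mat_adjoint U)
    in U * real_diag_mat n (\<lambda>i. f (d i)) * mat_adjoint U)"

definition mat_powr :: "complex mat \<Rightarrow> real \<Rightarrow> complex mat" where
  "mat_powr A t = mat_fun (\<lambda>x. x powr t) A"

definition mat_trace :: "complex mat \<Rightarrow> complex" where
  "mat_trace A = (\<Sum>i<dim_row A. A $$ (i, i))"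

definition mat_sum :: "nat \<Rightarrow> ('i \<Rightarrow> complex mat) \<Rightarrow> 'i set \<Rightarrow> complex mat" where
  "mat_sum n f I = mat n n (\<lambda>ij. \<Sum>k\<in>I. f k $$ ij)"

end

theory Submission
  imports Defs "Jordan_Normal_Form.Spectral_Radius"
begin

text \<open>
  Diagonalizing every matrix \<open>A i\<close> turns the argument \<open>H t\<close> of \<open>\<phi>\<close> into a sum
  \<open>\<Sum>j. exp (l j t) v\<^sub>j v\<^sub>j\<^sup>*\<close> of rank-one matrices with exponents linear in \<open>t\<close>. Fix a
  convex combination \<open>t\<^sub>0\<close> of two points and compress \<open>H t\<close> to the span of the top \<open>k\<close>
  eigenvectors of \<open>H t\<^sub>0\<close>. By the Cauchy--Binet formula the determinant of the compression
  is a sum of exponentials of linear functions of \<open>t\<close> with nonnegative coefficients, so it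
  is log-convex; at \<open>t\<^sub>0\<close> it equals the product of the top \<open>k\<close> eigenvalues of \<open>H t\<^sub>0\<close>, and
  everywhere else it is at most that of \<open>H t\<close>, again by Cauchy--Binet. Hence the logarithms
  of the eigenvalues of \<open>H t\<^sub>0\<close> are weakly majorized by the convex combination of the ordered
  logarithms at the two points, and the convex nondecreasing function
  \<open>\<lambda>s. \<phi> (exp s)\<close> respects weak majorization.
\<close>

section \<open>The Cauchy--Binet formula and Gram determinants\<close>

text \<open>Vectors are functions on \<open>nat\<close> without a dimension, so for
  \<open>k \<le> n\<close> the same \<open>J\<close>, \<open>c\<close>, \<open>v\<close> describe
  the leading \<open>k\<close> by \<open>k\<close> block: after a change of basis, compressing means
  lowering \<open>n\<close> to \<open>k\<close>.\<close>

definition rank_one_sum :: "nat \<Rightarrow> 'j set \<Rightarrow> ('j \<Rightarrow> real) \<Rightarrow> ('j \<Rightarrow> nat \<Rightarrow> complex) \<Rightarrow> complex mat" where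
  "rank_one_sum n J c v = mat n n (\<lambda>(r,s). \<Sum>j\<in>J. of_real (c j) * v j r * cnj (v j s))"

text \<open>The Cauchy-Binet expansion of \<open>det (rank_one_sum k J c v)\<close>, kept as a real
  number so that it can be ordered and put under \<open>ln\<close>. Each term is a product of
  weights times a nonnegative coefficient free of \<open>c\<close>.\<close>

definition gram_det :: "nat \<Rightarrow> 'j set \<Rightarrow> ('j \<Rightarrow> real) \<Rightarrow> ('j \<Rightarrow> nat \<Rightarrow> complex) \<Rightarrow> real" where
  "gram_det k J c v = (\<Sum>f\<in>PiE {0..<k} (\<lambda>_. J).
     (\<Prod>p\<in>{0..<k}. c (f p)) * (cmod (det (mat k k (\<lambda>(p,q). v (f p) q))))\<^sup>2) / fact k"

text \<open>
  Summing over all index functions rather than over \<open>k\<close>-subsets counts every subset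
  \<open>k!\<close> times; functions that are not injective contribute a vanishing determinant.
\<close>
lemma cauchy_binet_PiE:
  fixes a b :: "'j \<Rightarrow> nat \<Rightarrow> 'a::comm_ring_1"
  assumes J: "finite J"
  shows "of_nat (fact k) * det (mat k k (\<lambda>(p,q). \<Sum>j\<in>J. a j p * b j q)) =
    (\<Sum>f\<in>PiE {0..<k} (\<lambda>_. J). det (mat k k (\<lambda>(p,q). a (f p) q)) * det (mat k k (\<lambda>(p,q). b (f p) q)))"
proof -
  define F where "F = PiE {0..<k} (\<lambda>_. J)"
  define P where "P = {\<pi>. \<pi> permutes {0..<k}}"
  define B where "B f = mat k k (\<lambda>(p,q). b (f p) q)" for f
  let ?D = "det (mat k k (\<lambda>(p,q). \<Sum>j\<in>J. a j p * b j q))"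
  have finP: "finite P" unfolding P_def by (rule finite_permutations) simp
  have finF: "finite F" unfolding F_def by (rule finite_PiE) (use J in auto)
  \<comment> \<open>Expanding the row products over choice functions \<open>f\<close> gathers the
    \<open>b\<close> factors into a determinant but leaves the \<open>a\<close> factors as a single
    product.\<close>
  have expand: "?D = (\<Sum>f\<in>F. (\<Prod>p\<in>{0..<k}. a (f p) p) * det (B f))"
  proof -
    have "?D = (\<Sum>\<pi>\<in>P. signof \<pi> * (\<Prod>p\<in>{0..<k}. \<Sum>j\<in>J. a j p * b j (\<pi> p)))"
      unfolding P_def by (subst det_def'[of _ k]) (auto intro!: sum.cong prod.cong arg_cong2[where f = "(*)"])
    also have "\<dots> = (\<Sum>\<pi>\<in>P. \<Sum>f\<in>F. signof \<pi> * (\<Prod>p\<in>{0..<k}. a (f p) p * b (f p) (\<pi> p)))"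
      unfolding F_def by (subst prod_sum_PiE) (use J in \<open>auto simp: sum_distrib_left\<close>)
    also have "\<dots> = (\<Sum>f\<in>F. \<Sum>\<pi>\<in>P. signof \<pi> * (\<Prod>p\<in>{0..<k}. a (f p) p * b (f p) (\<pi> p)))"
      by (rule sum.swap)
    also have "\<dots> = (\<Sum>f\<in>F. (\<Prod>p\<in>{0..<k}. a (f p) p) * det (B f))"
    proof (rule sum.cong[OF refl])
      fix f
      have "det (B f) = (\<Sum>\<pi>\<in>P. signof \<pi> * (\<Prod>p\<in>{0..<k}. b (f p) (\<pi> p)))"
        unfolding P_def B_def
        by (subst det_def'[of _ k]) (auto intro!: sum.cong prod.cong arg_cong2[where f = "(*)"])
      then show "(\<Sum>\<pi>\<in>P. signof \<pi> * (\<Prod>p\<in>{0..<k}. a (f p) p * b (f p) (\<pi> p)))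
          = (\<Prod>p\<in>{0..<k}. a (f p) p) * det (B f)"
        by (simp add: sum_distrib_left prod.distrib mult_ac)
    qed
    finally show ?thesis .
  qed
  \<comment> \<open>Replacing \<open>f\<close> by \<open>f \<circ> \<sigma>\<close> permutes the
    rows of \<open>B f\<close> and brings out a sign. Summing these expressions for
    \<open>?D\<close> over all \<open>\<sigma>\<close> rebuilds the determinant of the
    \<open>a\<close> factors.\<close>
  have perm: "?D = (\<Sum>f\<in>F. signof \<sigma> * (\<Prod>p\<in>{0..<k}. a (f (\<sigma> p)) p) * det (B f))"
    if "\<sigma> \<in> P" for \<sigma>
  proof -
    have \<sigma>: "\<sigma> permutes {0..<k}" using that by (simp add: P_def)
    note inv = permutes_inv[OF \<sigma>]
    have maps: "f \<circ> \<tau> \<in> F" if "f \<in> F" and \<tau>: "\<tau> permutes {0..<k}" for f \<tau>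
      using that(1) permutes_in_image[OF \<tau>] unfolding F_def PiE_iff extensional_def by auto
    have "?D = (\<Sum>f\<in>F. (\<Prod>p\<in>{0..<k}. a ((f \<circ> \<sigma>) p) p) * det (B (f \<circ> \<sigma>)))"
      unfolding expand
      by (rule sum.reindex_bij_witness[of _ "\<lambda>f. f \<circ> \<sigma>" "\<lambda>f. f \<circ> Hilbert_Choice.inv \<sigma>"])
        (auto simp: maps \<sigma> inv comp_assoc permutes_inv_o[OF \<sigma>] permutes_surj)
    also have "\<dots> = (\<Sum>f\<in>F. signof \<sigma> * (\<Prod>p\<in>{0..<k}. a (f (\<sigma> p)) p) * det (B f))"
    proof (rule sum.cong[OF refl])
      fix f
      have "B (f \<circ> \<sigma>) = mat k k (\<lambda>(i,j). B f $$ (\<sigma> i, j))"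
        by (rule eq_matI) (use permutes_in_image[OF \<sigma>] in \<open>auto simp: B_def\<close>)
      then have "det (B (f \<circ> \<sigma>)) = signof \<sigma> * det (B f)"
        using det_permute_rows[OF _ \<sigma>, of "B f"] by (simp add: B_def)
      then show "(\<Prod>p\<in>{0..<k}. a ((f \<circ> \<sigma>) p) p) * det (B (f \<circ> \<sigma>))
          = signof \<sigma> * (\<Prod>p\<in>{0..<k}. a (f (\<sigma> p)) p) * det (B f)"
        by (simp add: mult_ac)
    qed
    finally show ?thesis .
  qed
  have "of_nat (fact k) * ?D = (\<Sum>\<sigma>\<in>P. ?D)"
    using card_permutations[of "{0..<k}" k] by (simp add: P_def)
  also have "\<dots> = (\<Sum>\<sigma>\<in>P. \<Sum>f\<in>F. signof \<sigma> * (\<Prod>p\<in>{0..<k}. a (f (\<sigma> p)) p) * det (B f))"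
    by (rule sum.cong[OF refl perm])
  also have "\<dots> = (\<Sum>f\<in>F. \<Sum>\<sigma>\<in>P. signof \<sigma> * (\<Prod>p\<in>{0..<k}. a (f (\<sigma> p)) p) * det (B f))"
    by (rule sum.swap)
  also have "\<dots> = (\<Sum>f\<in>F. det (mat k k (\<lambda>(p,q). a (f p) q)) * det (B f))"
  proof (rule sum.cong[OF refl])
    fix f
    have "det (mat k k (\<lambda>(p,q). a (f p) q)) = det (transpose_mat (mat k k (\<lambda>(p,q). a (f p) q)))"
      by (rule det_transpose[symmetric, of _ k]) simp
    also have "\<dots> = (\<Sum>\<sigma>\<in>P. signof \<sigma> * (\<Prod>p\<in>{0..<k}. a (f (\<sigma> p)) p))"
      unfolding P_def
      by (subst det_def'[of _ k])
        (auto intro!: sum.cong prod.cong arg_cong2[where f = "(*)"] simp: permutes_in_image)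
    finally show "(\<Sum>\<sigma>\<in>P. signof \<sigma> * (\<Prod>p\<in>{0..<k}. a (f (\<sigma> p)) p) * det (B f))
        = det (mat k k (\<lambda>(p,q). a (f p) q)) * det (B f)"
      by (simp add: sum_distrib_right)
  qed
  finally show ?thesis unfolding F_def B_def .
qed

text \<open>Cauchy-Binet with the weights put into the first factor: both minors come from the same
  vectors, one conjugated, so their product is a squared modulus times the selected weights.\<close>

lemma det_rank_one_sum:
  assumes J: "finite J"
  shows "det (rank_one_sum k J c v) = of_real (gram_det k J c v)"
proof -
  have eq: "det (mat k k (\<lambda>(p,q). of_real (c (f p)) * v (f p) q)) * det (mat k k (\<lambda>(p,q). cnj (v (f p) q)))
    = of_real ((\<Prod>p\<in>{0..<k}. c (f p)) * (cmod (det (mat k k (\<lambda>(p,q). v (f p) q))))\<^sup>2)" for f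
  proof -
    let ?W = "mat k k (\<lambda>(p,q). v (f p) q)"
    have W: "det ?W = (\<Sum>\<pi> | \<pi> permutes {0..<k}. signof \<pi> * (\<Prod>p\<in>{0..<k}. v (f p) (\<pi> p)))"
      by (subst det_def'[of _ k]) (auto intro!: sum.cong prod.cong arg_cong2[where f = "(*)"])
    have 1: "det (mat k k (\<lambda>(p,q). of_real (c (f p)) * v (f p) q))
        = (\<Prod>p\<in>{0..<k}. of_real (c (f p))) * det ?W"
    proof -
      have "det (mat k k (\<lambda>(p,q). of_real (c (f p)) * v (f p) q)) =
        (\<Sum>\<pi> | \<pi> permutes {0..<k}. signof \<pi> * (\<Prod>p\<in>{0..<k}. of_real (c (f p)) * v (f p) (\<pi> p)))"
        by (subst det_def'[of _ k]) (auto intro!: sum.cong prod.cong arg_cong2[where f = "(*)"])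
      then show ?thesis
        unfolding W by (simp add: prod.distrib sum_distrib_left mult_ac)
    qed
    have 2: "det (mat k k (\<lambda>(p,q). cnj (v (f p) q))) = cnj (det ?W)"
      unfolding W 
      by (subst det_def'[of _ k]) (auto intro!: sum.cong prod.cong arg_cong2[where f = "(*)"] simp: sign_def)
    show ?thesis
      unfolding 1 2 by (simp only: of_real_mult of_real_prod complex_norm_square mult.assoc)
  qed
  have "of_nat (fact k) * det (rank_one_sum k J c v) =
    (\<Sum>f\<in>PiE {0..<k} (\<lambda>_. J). of_real ((\<Prod>p\<in>{0..<k}. c (f p)) * (cmod (det (mat k k (\<lambda>(p,q). v (f p) q))))\<^sup>2))"
    unfolding rank_one_sum_def cauchy_binet_PiE[OF J] eq ..
  also have "\<dots> = of_nat (fact k) * of_real (gram_det k J c v)"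
    unfolding gram_det_def of_real_sum[symmetric] by simp
  finally show ?thesis by simp
qed

text \<open>Hoelder's inequality for a sum of exponentials whose nonnegative coefficients
  \<open>C f\<close> do not depend on the exponents. For the same reason positivity at one point
  passes to all others.\<close>

lemma gram_det_log_convex:
  fixes x y :: "'j \<Rightarrow> real"
  assumes J: "finite J" and u: "u \<ge> 0" and w: "w \<ge> 0" and uw: "u + w = 1"
    and pos: "0 < gram_det k J (\<lambda>j. exp (u * x j + w * y j)) v"
  shows "0 < gram_det k J (\<lambda>j. exp (x j)) v" "0 < gram_det k J (\<lambda>j. exp (y j)) v"
    and "ln (gram_det k J (\<lambda>j. exp (u * x j + w * y j)) v)
      \<le> u * ln (gram_det k J (\<lambda>j. exp (x j)) v) + w * ln (gram_det k J (\<lambda>j. exp (y j)) v)"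
proof -
  define F where "F = PiE {0..<k} (\<lambda>_. J)"
  define C where "C f = (cmod (det (mat k k (\<lambda>(p,q). v (f p) q))))\<^sup>2 / fact k" for f
  define X where "X f = (\<Sum>p\<in>{0..<k}. x (f p))" for f
  define Y where "Y f = (\<Sum>p\<in>{0..<k}. y (f p))" for f
  have uw': "1 - w = u" "w \<le> 1" using u uw by simp_all
  have finF: "finite F" unfolding F_def by (rule finite_PiE) (use J in auto)
  have C0: "C f \<ge> 0" for f by (simp add: C_def)
  have eq: "gram_det k J (\<lambda>j. exp (l j)) v = (\<Sum>f\<in>F. C f * exp (\<Sum>p\<in>{0..<k}. l (f p)))" for l
    by (simp add: gram_det_def F_def C_def exp_sum sum_divide_distrib mult_ac)
  have exuy: "(\<Sum>p\<in>{0..<k}. u * x (f p) + w * y (f p)) = u * X f + w * Y f" for f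
    by (simp add: X_def Y_def sum.distrib sum_distrib_left)
  obtain f where f: "f \<in> F" "C f > 0"
  proof -
    have "\<exists>f\<in>F. C f \<noteq> 0"
    proof (rule ccontr)
      assume "\<not> ?thesis"
      then have "gram_det k J (\<lambda>j. exp (u * x j + w * y j)) v = 0" unfolding eq by simp
      with pos show False by simp
    qed
    then show thesis using that C0 by (metis order_le_less)
  qed
  have posall: "0 < gram_det k J (\<lambda>j. exp (l j)) v" for l
    unfolding eq by (rule sum_pos2[OF finF f(1)]) (use f C0 in auto)
  show "0 < gram_det k J (\<lambda>j. exp (x j)) v" "0 < gram_det k J (\<lambda>j. exp (y j)) v" 
    by (rule posall)+
  define a where "a = gram_det k J (\<lambda>j. exp (x j)) v"
  define b where "b = gram_det k J (\<lambda>j. exp (y j)) v"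
  have ab: "a > 0" "b > 0" unfolding a_def b_def by (rule posall)+
  have a: "a = (\<Sum>f\<in>F. C f * exp (X f))" and b: "b = (\<Sum>f\<in>F. C f * exp (Y f))"
    unfolding a_def b_def eq X_def Y_def by simp_all
  \<comment> \<open>\<open>exp L\<close> is the claimed bound. Factoring it out and dividing the two
    sums by \<open>a\<close> and \<open>b\<close> normalizes both, so convexity of
    \<open>exp\<close>, applied termwise, adds up to \<open>u + w = 1\<close>.\<close>
  define L where "L = u * ln a + w * ln b"
  have "gram_det k J (\<lambda>j. exp (u * x j + w * y j)) v = (\<Sum>f\<in>F. C f * exp (u * X f + w * Y f))"
    unfolding eq exuy ..
  also have "\<dots> \<le> (\<Sum>f\<in>F. exp L * (u * (C f * exp (X f)) / a + w * (C f * exp (Y f)) / b))"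
  proof (rule sum_mono)
    fix f
    have "exp (u * (X f - ln a) + w * (Y f - ln b)) \<le> u * exp (X f - ln a) + w * exp (Y f - ln b)"
      using convex_onD[OF exp_convex, of w "X f - ln a" "Y f - ln b"] w u uw'
      by simp
    also have "\<dots> = u * exp (X f) / a + w * exp (Y f) / b"
      using ab by (simp add: exp_diff)
    finally have "exp L * exp (u * (X f - ln a) + w * (Y f - ln b))
        \<le> exp L * (u * exp (X f) / a + w * exp (Y f) / b)"
      by simp
    also have "exp L * exp (u * (X f - ln a) + w * (Y f - ln b)) = exp (u * X f + w * Y f)"
      unfolding exp_add[symmetric] L_def by (simp add: algebra_simps)
    finally have "C f * exp (u * X f + w * Y f)
        \<le> C f * (exp L * (u * exp (X f) / a + w * exp (Y f) / b))"
      using C0 mult_left_mono by blast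
    then show "C f * exp (u * X f + w * Y f)
        \<le> exp L * (u * (C f * exp (X f)) / a + w * (C f * exp (Y f)) / b)"
      by (simp add: algebra_simps)
  qed
  also have "\<dots> = exp L * (u * a / a + w * b / b)"
    unfolding a b sum_distrib_left sum_divide_distrib sum.distrib[symmetric] distrib_left by simp
  also have "\<dots> = exp L" using ab uw by simp
  finally show "ln (gram_det k J (\<lambda>j. exp (u * x j + w * y j)) v)
      \<le> u * ln (gram_det k J (\<lambda>j. exp (x j)) v) + w * ln (gram_det k J (\<lambda>j. exp (y j)) v)"
    using pos unfolding L_def a_def b_def by (metis exp_ln exp_le_cancel_iff)
qed

section \<open>Products of the largest weights\<close>

text \<open>The largest element of \<open>S\<close> is matched with the last index of the initial
  segment and both are removed; induction handles the rest.\<close>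

lemma prod_le_prod_initial:
  fixes d :: "nat \<Rightarrow> real"
  assumes pos: "\<And>i. i < n \<Longrightarrow> d i > 0"
    and dec: "\<And>i j. i \<le> j \<Longrightarrow> j < n \<Longrightarrow> d j \<le> d i"
  shows "S \<subseteq> {0..<n} \<Longrightarrow> card S = k \<Longrightarrow> prod d S \<le> prod d {0..<k}"
proof (induction k arbitrary: S)
  case 0
  then show ?case using finite_subset[OF 0(1)] by simp
next
  case (Suc k)
  have fin: "finite S" using Suc.prems(1) finite_subset by blast
  have ne: "S \<noteq> {}" using Suc.prems(2) by auto
  let ?m = "Max S"
  have m: "?m \<in> S" by (rule Max_in[OF fin ne])
  then have mn: "?m < n" using Suc.prems(1) by auto
  \<comment> \<open>\<open>S\<close> has \<open>Suc k\<close> elements inside a set of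
    \<open>Suc ?m\<close> elements, so \<open>k \<le> ?m\<close> and the weight at \<open>?m\<close>
    is at most \<open>d k\<close>.\<close>
  have "S \<subseteq> {0..?m}" using Max_ge[OF fin] by auto
  from card_mono[OF _ this] have km: "k \<le> ?m" using Suc.prems(2) by simp
  have IH: "prod d (S - {?m}) \<le> prod d {0..<k}"
    by (rule Suc.IH) (use Suc.prems m fin in auto)
  have "prod d S = d ?m * prod d (S - {?m})" by (rule prod.remove[OF fin m])
  also have "\<dots> \<le> d k * prod d {0..<k}"
  proof (rule mult_mono[OF dec[OF km mn] IH])
    show "0 \<le> d k" using pos[of k] km mn by simp
    show "0 \<le> prod d (S - {?m})"
      by (rule prod_nonneg) (use Suc.prems(1) pos in \<open>auto intro!: less_imp_le\<close>)
  qed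
  finally show ?case by (simp add: mult.commute)
qed

lemma det_not_inj_rows:
  assumes f: "\<not> inj_on f {0..<k}"
  shows "det (mat k k (\<lambda>(p,q). v (f p) q)) = (0::complex)"
proof -
  obtain i j where ij: "i < k" "j < k" "i \<noteq> j" "f i = f j" using f by (auto simp: inj_on_def)
  show ?thesis
    by (rule det_identical_rows[OF _ ij(3,1,2)]) (use ij in \<open>auto intro!: eq_vecI\<close>)
qed

text \<open>An injective \<open>f\<close> selects \<open>k\<close> distinct weights, whose product
  is at most that of the top \<open>k\<close>; a repeated row kills every other term. What remains
  is the same expansion with unit weights.\<close>

lemma gram_det_le_prod_initial:
  fixes d :: "nat \<Rightarrow> real"
  assumes pos: "\<And>i. i < n \<Longrightarrow> d i > 0"
    and dec: "\<And>i j. i \<le> j \<Longrightarrow> j < n \<Longrightarrow> d j \<le> d i"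
  shows "gram_det k {0..<n} d v \<le> prod d {0..<k} * gram_det k {0..<n} (\<lambda>_. 1) v"
proof -
  have "(\<Prod>p\<in>{0..<k}. d (f p)) * (cmod (det (mat k k (\<lambda>(p,q). v (f p) q))))\<^sup>2 / fact k
    \<le> prod d {0..<k} * ((cmod (det (mat k k (\<lambda>(p,q). v (f p) q))))\<^sup>2 / fact k)"
    if f: "f \<in> PiE {0..<k} (\<lambda>_. {0..<n})" for f
  proof (cases "inj_on f {0..<k}")
    case True
    then have "(\<Prod>p\<in>{0..<k}. d (f p)) = prod d (f ` {0..<k})"
      by (simp add: prod.reindex)
    also have "\<dots> \<le> prod d {0..<k}"
      by (rule prod_le_prod_initial[OF pos dec]) (use f True in \<open>auto simp: card_image\<close>)
    finally have "(\<Prod>p\<in>{0..<k}. d (f p)) \<le> prod d {0..<k}" .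
    from mult_right_mono[OF this, of "(cmod (det (mat k k (\<lambda>(p,q). v (f p) q))))\<^sup>2 / fact k"]
    show ?thesis by simp
  next
    case False
    then show ?thesis by (simp add: det_not_inj_rows)
  qed
  then show ?thesis
    unfolding gram_det_def sum_divide_distrib sum_distrib_left by (intro sum_mono) simp
qed

section \<open>Weak majorization\<close>

text \<open>The right derivative, an infimum of difference quotients, serves as the subgradient. Its
  sign and its monotonicity make it usable as a weight in summation by parts.\<close>

lemma convex_mono_subgradient:
  fixes \<psi> :: "real \<Rightarrow> real"
  assumes conv: "convex_on UNIV \<psi>" and mono: "mono \<psi>"
  obtains g where "\<And>x y. \<psi> x + g x * (y - x) \<le> \<psi> y" "\<And>x. 0 \<le> g x" "mono g"
proof -
  define g where "g x = Inf ((\<lambda>t. (\<psi> x - \<psi> t) / (x - t)) ` ({x<..} \<inter> UNIV))" for x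
  have sub: "\<psi> x + g x * (y - x) \<le> \<psi> y" for x y
    unfolding g_def by (rule convex_le_Inf_differential[OF conv]) auto
  have "0 \<le> g x" for x
    using sub[of x "x - 1"] monoD[OF mono, of "x - 1" x] by simp
  moreover have "mono g"
  proof (rule monoI)
    fix x y :: real assume "x \<le> y"
    show "g x \<le> g y"
    proof (cases "x = y")
      case False
      with \<open>x \<le> y\<close> have "x < y" by simp
      \<comment> \<open>The subgradient inequalities at \<open>x\<close> and at \<open>y\<close>,
        each tested at the other point, are added.\<close>
      have "(g x - g y) * (y - x) \<le> 0" using sub[of x y] sub[of y x] by (simp add: algebra_simps)
      with \<open>x < y\<close> show ?thesis by (simp add: mult_le_0_iff)
    qed simp
  qed
  ultimately show thesis using that sub by blast
qed

text \<open>Abel summation: the weighted sum is a nonnegative combination of the partial sums of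
  \<open>z\<close>, the coefficients being the drops of \<open>g\<close> and its last value.\<close>

lemma sum_antimono_weights_nonneg:
  fixes g z :: "nat \<Rightarrow> real"
  assumes nonneg: "\<And>i. i < n \<Longrightarrow> 0 \<le> g i"
    and dec: "\<And>i. Suc i < n \<Longrightarrow> g (Suc i) \<le> g i"
    and part: "\<And>k. k \<le> n \<Longrightarrow> 0 \<le> sum z {0..<k}"
  shows "0 \<le> (\<Sum>i\<in>{0..<n}. g i * z i)"
proof (cases n)
  case (Suc m)
  \<comment> \<open>A strengthened claim for the induction: since the plain partial sum is
    nonnegative, passing to the smaller next weight only lowers the bound.\<close>
  have "(\<Sum>i\<in>{0..<Suc k}. g i * z i) \<ge> g k * sum z {0..<Suc k}" if "k < n" for k
    using that
  proof (induction k)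
    case (Suc k)
    have "g (Suc k) * sum z {0..<Suc k} \<le> g k * sum z {0..<Suc k}"
      by (rule mult_right_mono) (use Suc.prems dec part[of "Suc k"] in auto)
    with Suc show ?case by (simp add: distrib_left)
  qed simp
  from this[of m] nonneg[of m] part[of n] Suc show ?thesis
    by (metis lessI mult_nonneg_nonneg order.refl order_trans)
qed simp

text \<open>The Tomic-Weyl inequality. Summing the subgradient inequalities at \<open>x i\<close>
  leaves the weights \<open>g (x i)\<close>, which decrease with \<open>i\<close> because
  \<open>x\<close> does and \<open>g\<close> is monotone.\<close>

lemma weak_majorization_sum_le:
  fixes \<psi> :: "real \<Rightarrow> real" and x y :: "nat \<Rightarrow> real"
  assumes conv: "convex_on UNIV \<psi>" and mono: "mono \<psi>"
    and dec: "\<And>i j. i \<le> j \<Longrightarrow> j < n \<Longrightarrow> x j \<le> x i"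
    and maj: "\<And>k. k \<le> n \<Longrightarrow> sum x {0..<k} \<le> sum y {0..<k}"
  shows "(\<Sum>i\<in>{0..<n}. \<psi> (x i)) \<le> (\<Sum>i\<in>{0..<n}. \<psi> (y i))"
proof -
  obtain g where g: "\<And>x y. \<psi> x + g x * (y - x) \<le> \<psi> y" "\<And>x. 0 \<le> g x" "mono g"
    using convex_mono_subgradient[OF conv mono] by blast
  have "0 \<le> (\<Sum>i\<in>{0..<n}. g (x i) * (y i - x i))"
    by (rule sum_antimono_weights_nonneg)
      (use g dec maj in \<open>auto simp: sum_subtractf intro!: monoD[OF g(3)]\<close>)
  also have "\<dots> \<le> (\<Sum>i\<in>{0..<n}. \<psi> (y i) - \<psi> (x i))"
    by (rule sum_mono) (use g(1) in \<open>simp add: algebra_simps\<close>)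
  finally show ?thesis by (simp add: sum_subtractf)
qed

section \<open>Unitary diagonalization\<close>

lemma dim_mat_adjoint [simp]: "dim_row (mat_adjoint A) = dim_col A"
    "dim_col (mat_adjoint A) = dim_row A"
  by (simp_all add: mat_adjoint_def)

lemma mat_adjoint_carrier [simp]: "A \<in> carrier_mat n m \<Longrightarrow> mat_adjoint A \<in> carrier_mat m n"
  by auto

lemma index_mat_adjoint [simp]:
  fixes A :: "complex mat"
  shows "i < dim_col A \<Longrightarrow> j < dim_row A \<Longrightarrow> mat_adjoint A $$ (i,j) = cnj (A $$ (j,i))"
  by (simp add: mat_adjoint_def mat_of_rows_def)

lemma index_mult_mat_sum:
  assumes "i < dim_row A" "j < dim_col B" "dim_col A = dim_row B"
  shows "(A * B) $$ (i,j) = (\<Sum>r\<in>{0..<dim_row B}. A $$ (i,r) * B $$ (r,j))"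
  using assms by (simp add: scalar_prod_def)

lemma mat_adjoint_mult:
  fixes A B :: "complex mat"
  assumes "A \<in> carrier_mat n m" "B \<in> carrier_mat m l"
  shows "mat_adjoint (A * B) = mat_adjoint B * mat_adjoint A"
  by (rule eq_matI)
      (use assms in \<open>auto simp: index_mult_mat_sum mult.commute simp del: index_mult_mat(1)\<close>)

lemma mat_adjoint_adjoint [simp]:
  fixes A :: "complex mat"
  shows "mat_adjoint (mat_adjoint A) = A"
  by (rule eq_matI) auto

text \<open>The spectral decomposition is a weighted sum over the columns of \<open>U\<close> rather
  than a triple product, so that the Gram determinant lemmas apply to it directly.\<close>

definition diagonalizes :: "nat \<Rightarrow> complex mat \<Rightarrow> complex mat \<Rightarrow> (nat \<Rightarrow> real) \<Rightarrow> bool" where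
  "diagonalizes n H U d \<longleftrightarrow> U \<in> carrier_mat n n \<and> mat_adjoint U * U = 1\<^sub>m n \<and>
     H = rank_one_sum n {0..<n} d (\<lambda>i r. U $$ (r,i))"

lemma unitary_adjoint_right:
  assumes "U \<in> carrier_mat n n" "mat_adjoint U * U = 1\<^sub>m n"
  shows "U * mat_adjoint U = 1\<^sub>m n"
  by (rule mat_mult_left_right_inverse[OF _ assms(1,2)]) (use assms in auto)

lemma mult_diag_adjoint:
  assumes U: "U \<in> carrier_mat n n"
  shows "U * real_diag_mat n d * mat_adjoint U = rank_one_sum n {0..<n} d (\<lambda>i r. U $$ (r,i))"
proof (rule eq_matI)
  have UD: "(U * real_diag_mat n d) $$ (i,j) = U $$ (i,j) * of_real (d j)" if "i < n"
      "j < n" for i j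
    using U that
    by (simp add: index_mult_mat_sum real_diag_mat_def if_distrib cong: if_cong del: index_mult_mat(1))
  fix i j assume "i < dim_row (rank_one_sum n {0..<n} d (\<lambda>i r. U $$ (r,i)))"
      "j < dim_col (rank_one_sum n {0..<n} d (\<lambda>i r. U $$ (r,i)))"
  then have ij: "i < n" "j < n" by (simp_all add: rank_one_sum_def)
  have "(U * real_diag_mat n d * mat_adjoint U) $$ (i,j)
      = (\<Sum>r\<in>{0..<n}. (U * real_diag_mat n d) $$ (i,r) * mat_adjoint U $$ (r,j))"
    using U ij by (subst index_mult_mat_sum) (auto simp: real_diag_mat_def)
  also have "\<dots> = (\<Sum>r\<in>{0..<n}. of_real (d r) * U $$ (i,r) * cnj (U $$ (j,r)))"
    by (rule sum.cong) (use U ij UD in auto)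
  finally show "(U * real_diag_mat n d * mat_adjoint U) $$ (i,j)
      = rank_one_sum n {0..<n} d (\<lambda>i r. U $$ (r,i)) $$ (i,j)"
    using ij by (simp add: rank_one_sum_def)
qed (use U in \<open>simp_all add: rank_one_sum_def real_diag_mat_def\<close>)

text \<open>The vector is completed to a basis, which is then orthogonalized. Gram-Schmidt keeps the
  first vector, and \<open>c\<close> absorbs its normalization.\<close>

lemma unitary_with_first_column:
  assumes v: "v \<in> carrier_vec n" and v0: "v \<noteq> 0\<^sub>v n"
  obtains W c where "W \<in> carrier_mat n n" "mat_adjoint W * W = 1\<^sub>m n"
      "col W 0 = c \<cdot>\<^sub>v (v :: complex vec)"
proof -
  interpret cof_vec_space n "TYPE(complex)" .
  have n: "n \<noteq> 0" using v v0 by auto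
  define b where "b = basis_completion v"
  from basis_completion[OF v v0, folded b_def]
  have dist_b: "distinct b" and indep: "\<not> lin_dep (set b)" and b: "set b \<subseteq> carrier_vec n"
    and hdb: "hd b = v" and len_b: "length b = n" by auto
  define ws where "ws = gram_schmidt n b"
  obtain vs where bv: "b = v # vs" using hdb len_b n by (cases b) auto
  from gram_schmidt_result[OF b dist_b indep refl, folded ws_def]
  have ws: "set ws \<subseteq> carrier_vec n" "corthogonal ws" "length ws = n" by (auto simp: len_b)
  have hdws: "ws ! 0 = v"
  proof -
    have "ws \<noteq> []" using ws(3) n by auto
    then show ?thesis using gram_schmidt_hd[OF v, of vs, folded bv] hd_conv_nth[of ws] unfolding ws_def by simp
  qed
  have wsn: "ws ! i \<in> carrier_vec n" if "i < n" for i using ws that by auto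
  have dimws: "dim_vec (ws ! i) = n" if "i < n" for i using wsn[OF that] by auto
  define N where "N i = (\<Sum>r\<in>{0..<n}. (cmod (ws ! i $ r))\<^sup>2)" for i
  have orth: "(\<Sum>r\<in>{0..<n}. cnj (ws ! i $ r) * ws ! j $ r) = (if i = j then of_real (N i) else 0)"
    if "i < n" "j < n" for i j
  proof (cases "i = j")
    case True
    show ?thesis using True unfolding N_def by (simp add: complex_norm_square mult.commute del: of_real_power)
  next
    case False
    have "ws ! j \<bullet>c ws ! i = 0" using corthogonalD[OF ws(2), of j i] that ws(3) False by auto
    then show ?thesis using False that dimws by (simp add: scalar_prod_def mult.commute)
  qed
  have Npos: "N i > 0" if "i < n" for i
  proof -
    have "ws ! i \<bullet>c ws ! i \<noteq> 0" using corthogonalD[OF ws(2), of i i] that ws(3) by auto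
    moreover have "ws ! i \<bullet>c ws ! i = of_real (N i)"
      using orth[OF that that] dimws[OF that] by (simp add: scalar_prod_def mult.commute)
    ultimately have "N i \<noteq> 0" by auto
    moreover have "N i \<ge> 0" unfolding N_def by (simp add: sum_nonneg)
    ultimately show ?thesis by simp
  qed
  \<comment> \<open>The vectors obtained so far are orthogonal with squared length
    \<open>N i\<close>, hence the division by the length.\<close>
  define W where "W = mat n n (\<lambda>(r,i). ws ! i $ r / of_real (sqrt (N i)))"
  have W: "W \<in> carrier_mat n n" by (simp add: W_def)
  have "mat_adjoint W * W = 1\<^sub>m n"
  proof (rule eq_matI)
    fix i j assume "i < dim_row (1\<^sub>m n :: complex mat)" "j < dim_col (1\<^sub>m n :: complex mat)"
    then have ij: "i < n" "j < n" by auto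
    have "(mat_adjoint W * W) $$ (i,j)
        = (\<Sum>r\<in>{0..<n}. cnj (ws ! i $ r) * ws ! j $ r) / of_real (sqrt (N i) * sqrt (N j))"
      using ij W by (subst index_mult_mat_sum) (auto simp: W_def sum_divide_distrib)
    also have "\<dots> = (1\<^sub>m n) $$ (i,j)"
      using ij orth[OF ij] Npos[OF ij(1)] by (cases "i = j") (simp_all add: less_imp_le flip: of_real_mult)
    finally show "(mat_adjoint W * W) $$ (i,j) = 1\<^sub>m n $$ (i,j)" .
  qed (simp_all add: W_def)
  moreover have "col W 0 = (1 / of_real (sqrt (N 0))) \<cdot>\<^sub>v v"
    by (rule eq_vecI) (use n v hdws in \<open>auto simp: W_def\<close>)
  ultimately show thesis using that W by blast
qed

text \<open>Deflation: a unitary whose first column lies along an eigenvector splits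
  \<open>H\<close> into a scalar and a Hermitian block of size \<open>n\<close>, to which the
  induction hypothesis applies.\<close>

lemma hermitian_diagonalizable:
  assumes "H \<in> carrier_mat n n" "mat_adjoint H = H"
  shows "\<exists>U d. diagonalizes n H U d"
  using assms
proof (induction n arbitrary: H)
  case 0
  have "diagonalizes 0 H (1\<^sub>m 0) (\<lambda>_. 0)"
    using 0 by (auto simp: diagonalizes_def rank_one_sum_def intro!: eq_matI)
  then show ?case by blast
next
  case (Suc n)
  let ?N = "Suc n"
  note H = Suc.prems(1) and herm = Suc.prems(2)
  obtain e v where "eigenvector H v e"
    using spectrum_non_empty[OF H] unfolding spectrum_def eigenvalue_def by auto
  then have v: "v \<in> carrier_vec ?N" "v \<noteq> 0\<^sub>v ?N" and ev: "H *\<^sub>v v = e \<cdot>\<^sub>v v"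
    using H unfolding eigenvector_def by auto
  obtain W c where W: "W \<in> carrier_mat ?N ?N" and WW: "mat_adjoint W * W = 1\<^sub>m ?N"
      and colW: "col W 0 = c \<cdot>\<^sub>v v"
    using unitary_with_first_column[OF v] by blast
  note WW' = unitary_adjoint_right[OF W WW]
  define W' where "W' = mat_adjoint W"
  have W': "W' \<in> carrier_mat ?N ?N" using W by (simp add: W'_def)
  define K where "K = W' * H * W"
  have K: "K \<in> carrier_mat ?N ?N" using W W' H by (simp add: K_def)
  have hermK: "mat_adjoint K = K"
    unfolding K_def W'_def using W H W'
    by (simp add: mat_adjoint_mult[of _ ?N ?N _ ?N] W'_def herm assoc_mult_mat[of _ ?N ?N _ ?N _ ?N])
  have HWK: "H = W * K * W'"
  proof -
    have "W * K * W' = (W * W') * H * (W * W')"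
      unfolding K_def using W W' H by (simp add: assoc_mult_mat[of _ ?N ?N _ ?N _ ?N])
    then show ?thesis using WW' H by (simp add: W'_def)
  qed
  \<comment> \<open>The first column of \<open>W\<close> is an eigenvector, so the first column of
    \<open>K\<close> is \<open>e\<close> times the first column of
    \<open>mat_adjoint W * W\<close>.\<close>
  have col0: "K $$ (i,0) = (if i = 0 then e else 0)" if "i < ?N" for i
  proof -
    have HW: "H *\<^sub>v col W 0 = e \<cdot>\<^sub>v col W 0"
      unfolding colW using H v(1) by (simp add: mult_mat_vec ev smult_smult_assoc mult.commute)
    have "K = W' * (H * W)" unfolding K_def using W W' H by (simp add: assoc_mult_mat[of _ ?N ?N _ ?N _ ?N])
    then have "K $$ (i,0) = row W' i \<bullet> col (H * W) 0" using that W W' H by simp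
    also have "col (H * W) 0 = e \<cdot>\<^sub>v col W 0" using HW H W by (subst col_mult2[of _ ?N ?N _ ?N]) auto
    also have "row W' i \<bullet> (e \<cdot>\<^sub>v col W 0) = e * (row W' i \<bullet> col W 0)"
      by (rule scalar_prod_smult_distrib[of _ ?N]; rule carrier_vecI) (use W W' in simp_all)
    also have "row W' i \<bullet> col W 0 = (W' * W) $$ (i,0)" using W W' that by simp
    finally have "K $$ (i,0) = e * (1\<^sub>m ?N) $$ (i,0)" unfolding W'_def WW .
    then show ?thesis using that by auto
  qed
  have Ksym: "K $$ (i,j) = cnj (K $$ (j,i))" if "i < ?N" "j < ?N" for i j
    using arg_cong[OF hermK, of "\<lambda>M. M $$ (i,j)"] that K by simp
  have e: "e = of_real (Re e)"
    using Ksym[of 0 0] col0[of 0] by (simp add: complex_eq_iff)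
  define K3 where "K3 = mat n n (\<lambda>(i,j). K $$ (Suc i, Suc j))"
  have K3: "K3 \<in> carrier_mat n n" by (simp add: K3_def)
  have "mat_adjoint K3 = K3"
    by (rule eq_matI) (auto simp: K3_def Ksym[of "Suc _" "Suc _", symmetric])
  from Suc.IH[OF K3 this] obtain V d where V: "V \<in> carrier_mat n n"
      and VV: "mat_adjoint V * V = 1\<^sub>m n"
    and K3V: "K3 = rank_one_sum n {0..<n} d (\<lambda>i r. V $$ (r,i))"
    unfolding diagonalizes_def by blast
  \<comment> \<open>\<open>P\<close> is the block sum of the scalar 1 and \<open>V\<close>, and
    \<open>d'\<close> puts the eigenvalue \<open>Re e\<close> in front of \<open>d\<close>; the
    product \<open>W * P\<close> will diagonalize \<open>H\<close>.\<close>
  define P where "P = mat ?N ?N (\<lambda>(i,j). case i of 0 \<Rightarrow> (if j = 0 then 1 else 0)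
    | Suc i' \<Rightarrow> (case j of 0 \<Rightarrow> 0 | Suc j' \<Rightarrow> V $$ (i',j')))"
  define d' where "d' = case_nat (Re e) d"
  have P: "P \<in> carrier_mat ?N ?N" by (simp add: P_def)
  define P' where "P' = mat_adjoint P"
  have P': "P' \<in> carrier_mat ?N ?N" using P by (simp add: P'_def)
  have PP: "P' * P = 1\<^sub>m ?N"
  proof (rule eq_matI)
    fix i j assume "i < dim_row (1\<^sub>m ?N :: complex mat)" "j < dim_col (1\<^sub>m ?N :: complex mat)"
    then have ij: "i < ?N" "j < ?N" by auto
    have VVi: "(\<Sum>r\<in>{0..<n}. cnj (V $$ (r,a)) * V $$ (r,b)) = (if a = b then 1 else 0)" if "a < n"
        "b < n" for a b
      using arg_cong[OF VV, of "\<lambda>M. M $$ (a,b)"] that V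
      by (simp add: index_mult_mat_sum del: index_mult_mat(1))
    have "(P' * P) $$ (i,j) = (\<Sum>r\<in>{0..<?N}. cnj (P $$ (r,i)) * P $$ (r,j))"
      using ij P unfolding P'_def by (subst index_mult_mat_sum) auto
    also have "\<dots> = 1\<^sub>m ?N $$ (i,j)"
      unfolding sum.atLeast0_lessThan_Suc_shift
      using ij VVi by (cases i; cases j) (auto simp: P_def)
    finally show "(P' * P) $$ (i,j) = 1\<^sub>m ?N $$ (i,j)" .
  qed (use P P' in auto)
  have KP: "K = P * real_diag_mat ?N d' * P'"
    unfolding P'_def mult_diag_adjoint[OF P]
  proof (rule eq_matI)
    fix i j assume "i < dim_row (rank_one_sum ?N {0..<?N} d' (\<lambda>i r. P $$ (r,i)))"
        "j < dim_col (rank_one_sum ?N {0..<?N} d' (\<lambda>i r. P $$ (r,i)))"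
    then have ij: "i < ?N" "j < ?N" by (simp_all add: rank_one_sum_def)
    have KS: "K $$ (Suc a, Suc b) = (\<Sum>j\<in>{0..<n}. of_real (d j) * V $$ (a,j) * cnj (V $$ (b,j)))"
        if "a < n" "b < n" for a b
      using arg_cong[OF K3V, of "\<lambda>M. M $$ (a,b)"] that by (simp add: K3_def rank_one_sum_def)
    have row0: "K $$ (0, Suc b) = 0" if "b < n" for b
      using Ksym[of 0 "Suc b"] col0[of "Suc b"] that by simp
    have "rank_one_sum ?N {0..<?N} d' (\<lambda>i r. P $$ (r,i)) $$ (i,j)
        = (\<Sum>r\<in>{0..<?N}. of_real (d' r) * P $$ (i,r) * cnj (P $$ (j,r)))"
      using ij by (simp add: rank_one_sum_def)
    also have "\<dots> = K $$ (i,j)"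
      unfolding sum.atLeast0_lessThan_Suc_shift
      using ij col0 row0 KS e[symmetric] by (cases i; cases j) (auto simp: P_def d'_def)
    finally show "K $$ (i,j) = rank_one_sum ?N {0..<?N} d' (\<lambda>i r. P $$ (r,i)) $$ (i,j)" ..
  qed (use K in \<open>simp_all add: rank_one_sum_def\<close>)
  define U where "U = W * P"
  have U: "U \<in> carrier_mat ?N ?N" using W P by (simp add: U_def)
  have adjU: "mat_adjoint U = P' * W'"
    unfolding U_def P'_def W'_def by (rule mat_adjoint_mult[OF W P])
  have D: "real_diag_mat ?N d' \<in> carrier_mat ?N ?N" by (simp add: real_diag_mat_def)
  have "mat_adjoint U * U = P' * (W' * W) * P"
    unfolding adjU unfolding U_def using W W' P P' by (simp add: assoc_mult_mat[of _ ?N ?N _ ?N _ ?N])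
  also have "\<dots> = 1\<^sub>m ?N" using WW PP P' by (simp add: W'_def)
  finally have "mat_adjoint U * U = 1\<^sub>m ?N" .
  moreover have "H = U * real_diag_mat ?N d' * mat_adjoint U"
    unfolding adjU unfolding U_def HWK KP using W W' P P' D
    by (simp add: assoc_mult_mat[of _ ?N ?N _ ?N _ ?N])
  ultimately have "diagonalizes ?N H U d'"
    unfolding diagonalizes_def mult_diag_adjoint[OF U] using U by simp
  then show ?case by blast
qed

section \<open>Eigenvalues of sums of rank-one matrices\<close>

lemma real_diag_mat_carrier [simp]: "real_diag_mat n d \<in> carrier_mat n n"
  by (simp add: real_diag_mat_def)

lemma rank_one_sum_carrier [simp]: "rank_one_sum n J c v \<in> carrier_mat n n"
  by (simp add: rank_one_sum_def)

lemma index_rank_one_sum: "r < n \<Longrightarrow> s < n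
    \<Longrightarrow> rank_one_sum n J c v $$ (r,s) = (\<Sum>j\<in>J. of_real (c j) * v j r * cnj (v j s))"
  by (simp add: rank_one_sum_def)

lemma mat_adjoint_rank_one_sum: "mat_adjoint (rank_one_sum n J c v) = rank_one_sum n J c v"
  by (rule eq_matI) (auto simp: rank_one_sum_def mult_ac)

text \<open>Congruence acts on each rank-one term separately and moves only its vector. The weights
  survive, so their exponents stay linear in \<open>t\<close> under every later change of
  basis.\<close>

lemma rank_one_sum_congruence:
  assumes X: "X \<in> carrier_mat n n"
  shows "mat_adjoint X * rank_one_sum n J c v * X
      = rank_one_sum n J c (\<lambda>j p. \<Sum>r\<in>{0..<n}. cnj (X $$ (r,p)) * v j r)"
proof -
  define w where "w j p = (\<Sum>r\<in>{0..<n}. cnj (X $$ (r,p)) * v j r)" for j p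
  have "mat_adjoint X * rank_one_sum n J c v * X = rank_one_sum n J c w"
  proof (rule eq_matI)
    fix p q assume "p < dim_row (rank_one_sum n J c w)" "q < dim_col (rank_one_sum n J c w)"
    then have pq: "p < n" "q < n" by (simp_all add: rank_one_sum_def)
    have XR: "(mat_adjoint X * rank_one_sum n J c v) $$ (p,s)
        = (\<Sum>j\<in>J. of_real (c j) * w j p * cnj (v j s))"
      if "s < n" for s
    proof -
      have "(mat_adjoint X * rank_one_sum n J c v) $$ (p,s)
          = (\<Sum>r\<in>{0..<n}. \<Sum>j\<in>J. cnj (X $$ (r,p)) * (of_real (c j) * v j r * cnj (v j s)))"
        using X pq that by (subst index_mult_mat_sum) (auto simp: rank_one_sum_def sum_distrib_left)
      also have "\<dots> = (\<Sum>j\<in>J. \<Sum>r\<in>{0..<n}. cnj (X $$ (r,p)) * (of_real (c j) * v j r * cnj (v j s)))"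
        by (rule sum.swap)
      finally show ?thesis by (simp add: w_def sum_distrib_left sum_distrib_right mult_ac)
    qed
    have cw: "(\<Sum>s\<in>{0..<n}. cnj (v j s) * X $$ (s,q)) = cnj (w j q)" for j
      by (simp add: w_def mult.commute)
    have "(mat_adjoint X * rank_one_sum n J c v * X) $$ (p,q)
        = (\<Sum>s\<in>{0..<n}. (mat_adjoint X * rank_one_sum n J c v) $$ (p,s) * X $$ (s,q))"
      using X pq by (subst index_mult_mat_sum) (auto simp: rank_one_sum_def simp del: index_mult_mat(1))
    also have "\<dots> = (\<Sum>s\<in>{0..<n}. \<Sum>j\<in>J. of_real (c j) * w j p * (cnj (v j s) * X $$ (s,q)))"
      by (rule sum.cong) (simp_all add: XR sum_distrib_right mult.assoc del: index_mult_mat(1))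
    also have "\<dots> = (\<Sum>j\<in>J. \<Sum>s\<in>{0..<n}. of_real (c j) * w j p * (cnj (v j s) * X $$ (s,q)))"
      by (rule sum.swap)
    also have "\<dots> = (\<Sum>j\<in>J. of_real (c j) * w j p * cnj (w j q))"
      unfolding sum_distrib_left[symmetric] cw ..
    finally show "(mat_adjoint X * rank_one_sum n J c v * X) $$ (p,q)
        = rank_one_sum n J c w $$ (p,q)"
      using pq by (simp add: index_rank_one_sum)
  qed (use X in \<open>auto simp: rank_one_sum_def\<close>)
  then show ?thesis by (simp add: w_def[abs_def])
qed

text \<open>The Gram determinant is a leading principal minor and thus depends on the matrix alone,
  which lets one rank-one representation be traded for another.\<close>

lemma gram_det_leading_eq:
  assumes "rank_one_sum n J c v = rank_one_sum n J' c' v'" "k \<le> n" "finite J" "finite J'"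
  shows "gram_det k J c v = gram_det k J' c' v'"
proof -
  have "rank_one_sum k J c v = rank_one_sum k J' c' v'"
  proof (rule eq_matI)
    fix i j assume "i < dim_row (rank_one_sum k J' c' v')" "j < dim_col (rank_one_sum k J' c' v')"
    then have ij: "i < k" "j < k" by (simp_all add: rank_one_sum_def)
    then show "rank_one_sum k J c v $$ (i,j) = rank_one_sum k J' c' v' $$ (i,j)"
      using arg_cong[OF assms(1), of "\<lambda>M. M $$ (i,j)"] assms(2) by (simp add: index_rank_one_sum)
  qed (simp_all add: rank_one_sum_def)
  then show ?thesis using det_rank_one_sum[of J] det_rank_one_sum[of J'] assms(3,4) by (metis of_real_eq_iff)
qed

lemma det_real_diag_mat: "det (real_diag_mat n d) = of_real (\<Prod>i\<in>{0..<n}. d i)"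
proof -
  have "det (real_diag_mat n d) = prod_list (diag_mat (real_diag_mat n d))"
    by (rule det_upper_triangular[of _ n]) (auto simp: real_diag_mat_def)
  also have "diag_mat (real_diag_mat n d) = map (\<lambda>i. of_real (d i)) [0..<n]"
    by (simp add: diag_mat_def real_diag_mat_def)
  also have "prod_list \<dots> = (\<Prod>i\<in>{0..<n}. of_real (d i))"
    using prod.distinct_set_conv_list[of "[0..<n]" "\<lambda>i. of_real (d i) :: complex"] by simp
  finally show ?thesis by simp
qed

text \<open>Serves for a matrix written in its own eigenbasis, where the minor is a product of
  eigenvalues, and for the identity, where it is 1.\<close>

lemma gram_det_leading_diag:
  assumes "rank_one_sum n J c v = real_diag_mat n d" "k \<le> n" "finite J"
  shows "gram_det k J c v = (\<Prod>i\<in>{0..<k}. d i)"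
proof -
  have "rank_one_sum k J c v = real_diag_mat k d"
  proof (rule eq_matI)
    fix i j assume "i < dim_row (real_diag_mat k d)" "j < dim_col (real_diag_mat k d)"
    then have ij: "i < k" "j < k" by (simp_all add: real_diag_mat_def)
    then show "rank_one_sum k J c v $$ (i,j) = real_diag_mat k d $$ (i,j)"
      using arg_cong[OF assms(1), of "\<lambda>M. M $$ (i,j)"] assms(2) by (simp add: index_rank_one_sum real_diag_mat_def)
  qed (simp_all add: rank_one_sum_def real_diag_mat_def)
  then show ?thesis using det_rank_one_sum[OF assms(3), of k c v] det_real_diag_mat[of k d]
    by (metis of_real_eq_iff)
qed

lemma real_diag_mat_one: "real_diag_mat n (\<lambda>_. 1) = 1\<^sub>m n"
  by (rule eq_matI) (auto simp: real_diag_mat_def)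

lemma diagonalizes_congruence:
  assumes "diagonalizes n H U d"
  shows "mat_adjoint U * H * U = real_diag_mat n d"
proof -
  have U: "U \<in> carrier_mat n n" and UU: "mat_adjoint U * U = 1\<^sub>m n"
    and H: "H = U * real_diag_mat n d * mat_adjoint U"
    using assms mult_diag_adjoint[of U n d] by (simp_all add: diagonalizes_def)
  define U' where "U' = mat_adjoint U"
  have U': "U' \<in> carrier_mat n n" using U by (simp add: U'_def)
  have "U' * H * U = (U' * U) * real_diag_mat n d * (U' * U)"
    unfolding H U'_def[symmetric]
    using U U' by (simp add: assoc_mult_mat[of _ n n _ n _ n] mult_carrier_mat[of _ n n _ n])
  then show ?thesis
    unfolding U'_def UU left_mult_one_mat[OF real_diag_mat_carrier] right_mult_one_mat[OF real_diag_mat_carrier] .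
qed

section \<open>Functional calculus, traces and ordered spectra\<close>

text \<open>The choice made by \<open>SOME\<close> in \<open>mat_fun\<close> involves
  \<open>H\<close> but not \<open>f\<close>, so one pair \<open>U\<close>, \<open>d\<close>
  describes \<open>mat_fun f H\<close> for every \<open>f\<close> at once.\<close>

lemma diagonalizes_mat_fun:
  assumes H: "H \<in> carrier_mat n n" and herm: "mat_adjoint H = H"
  obtains U d where "diagonalizes n H U d"
      "\<And>f. mat_fun f H = rank_one_sum n {0..<n} (\<lambda>i. f (d i)) (\<lambda>i r. U $$ (r,i))"
proof -
  define Q where "Q
      = (\<lambda>(U,d). U \<in> carrier_mat n n \<and> unitary_mat U \<and> H = U * real_diag_mat n d * mat_adjoint U)"
  have Q: "Q (U,d) \<longleftrightarrow> diagonalizes n H U d" for U d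
    using mult_diag_adjoint[of U n d] by (auto simp: Q_def diagonalizes_def unitary_mat_def)
  define S where "S = (SOME z. Q z)"
  obtain U d where S: "S = (U,d)" by (cases S)
  have "\<exists>z. Q z" using hermitian_diagonalizable[OF H herm] Q by blast
  then have "Q S" unfolding S_def by (rule someI_ex)
  then have D: "diagonalizes n H U d" by (simp add: S Q)
  then have U: "U \<in> carrier_mat n n" by (simp add: diagonalizes_def)
  have "mat_fun f H = rank_one_sum n {0..<n} (\<lambda>i. f (d i)) (\<lambda>i r. U $$ (r,i))" for f
  proof -
    have "dim_row H = n" using H by simp
    then have "mat_fun f H = (case S of (U,d) \<Rightarrow> U * real_diag_mat n (\<lambda>i. f (d i)) * mat_adjoint U)"
      by (simp add: mat_fun_def Let_def S_def Q_def)
    then show ?thesis using mult_diag_adjoint[OF U] by (simp add: S)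
  qed
  with D show thesis using that by blast
qed

lemma unitary_column_norm:
  assumes "U \<in> carrier_mat n n" "mat_adjoint U * U = 1\<^sub>m n" "i < n"
  shows "(\<Sum>r\<in>{0..<n}. cnj (U $$ (r,i)) * U $$ (r,i)) = 1"
  using arg_cong[OF assms(2), of "\<lambda>M. M $$ (i,i)"] assms(1,3)
  by (simp add: index_mult_mat_sum del: index_mult_mat(1))

lemma trace_diagonalized:
  assumes "U \<in> carrier_mat n n" "mat_adjoint U * U = 1\<^sub>m n"
  shows "mat_trace (rank_one_sum n {0..<n} d (\<lambda>i r. U $$ (r,i))) = of_real (\<Sum>i\<in>{0..<n}. d i)"
proof -
  have "mat_trace (rank_one_sum n {0..<n} d (\<lambda>i r. U $$ (r,i)))
      = (\<Sum>r\<in>{0..<n}. \<Sum>i\<in>{0..<n}. of_real (d i) * U $$ (r,i) * cnj (U $$ (r,i)))"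
    by (auto simp: mat_trace_def index_rank_one_sum carrier_matD[OF rank_one_sum_carrier] lessThan_atLeast0)
  also have "\<dots> = (\<Sum>i\<in>{0..<n}. \<Sum>r\<in>{0..<n}. of_real (d i) * U $$ (r,i) * cnj (U $$ (r,i)))"
    by (rule sum.swap)
  also have "\<dots> = (\<Sum>i\<in>{0..<n}. of_real (d i) * (\<Sum>r\<in>{0..<n}. cnj (U $$ (r,i)) * U $$ (r,i)))"
    by (simp add: sum_distrib_left mult_ac)
  also have "\<dots> = of_real (\<Sum>i\<in>{0..<n}. d i)"
    by (simp add: unitary_column_norm[OF assms])
  finally show ?thesis .
qed

text \<open>Permuting the columns of \<open>U\<close> along with the eigenvalues preserves the
  rank-one sum. \<open>p\<close> is returned so that sums over the original order can be carried
  over.\<close>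

lemma diagonalizes_sorted:
  assumes "diagonalizes n H U d"
  obtains p U' where "p permutes {0..<n}" "diagonalizes n H U' (d \<circ> p)"
    "\<And>i j. i \<le> j \<Longrightarrow> j < n \<Longrightarrow> d (p j) \<le> d (p i)"
proof -
  have U: "U \<in> carrier_mat n n" and UU: "mat_adjoint U * U = 1\<^sub>m n"
    and H: "H = rank_one_sum n {0..<n} d (\<lambda>i r. U $$ (r,i))"
    using assms by (simp_all add: diagonalizes_def)
  \<comment> \<open>The list of eigenvalues and its decreasing rearrangement have the same multiset;
    this supplies \<open>p\<close>.\<close>
  let ?l = "map d [0..<n]"
  obtain p where p: "p permutes {..<length ?l}" and pl: "permute_list p ?l = rev (sort ?l)"
    by (rule mset_eq_permutation[of "rev (sort ?l)" ?l]) auto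
  have p': "p permutes {0..<n}" using p by (simp add: lessThan_atLeast0)
  have pin: "p i < n" if "i < n" for i using permutes_in_image[OF p'] that by simp
  have nth: "rev (sort ?l) ! i = d (p i)" if "i < n" for i
    unfolding pl[symmetric] using permute_list_nth[OF p, of i] that pin by simp
  have dec: "d (p j) \<le> d (p i)" if "i \<le> j" "j < n" for i j
  proof -
    have "sorted_wrt (\<ge>) (rev (sort ?l))" by (simp add: sorted_wrt_rev)
    then show ?thesis
      using nth[of i] nth[of j] that sorted_wrt_nth_less[of "(\<ge>)" "rev (sort ?l)" i j]
      by (cases "i = j") simp_all
  qed
  define U' where "U' = mat n n (\<lambda>(r,i). U $$ (r, p i))"
  have U': "U' \<in> carrier_mat n n" by (simp add: U'_def)
  have "mat_adjoint U' * U' = 1\<^sub>m n"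
  proof (rule eq_matI)
    fix i j assume "i < dim_row (1\<^sub>m n :: complex mat)" "j < dim_col (1\<^sub>m n :: complex mat)"
    then have ij: "i < n" "j < n" by auto
    have "(mat_adjoint U' * U') $$ (i,j) = (mat_adjoint U * U) $$ (p i, p j)"
      using ij pin U U' by (simp add: index_mult_mat_sum U'_def del: index_mult_mat(1))
    also have "\<dots> = 1\<^sub>m n $$ (i,j)"
      unfolding UU using ij pin permutes_inj[OF p'] by (auto simp: inj_eq)
    finally show "(mat_adjoint U' * U') $$ (i,j) = 1\<^sub>m n $$ (i,j)" .
  qed (simp_all add: U'_def)
  moreover have "H = rank_one_sum n {0..<n} (d \<circ> p) (\<lambda>i r. U' $$ (r,i))"
    unfolding H
  proof (rule eq_matI)
    fix r s assume "r < dim_row (rank_one_sum n {0..<n} (d \<circ> p) (\<lambda>i r. U' $$ (r,i)))"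
        "s < dim_col (rank_one_sum n {0..<n} (d \<circ> p) (\<lambda>i r. U' $$ (r,i)))"
    then have rs: "r < n" "s < n" by (simp_all add: rank_one_sum_def)
    have "rank_one_sum n {0..<n} d (\<lambda>i r. U $$ (r,i)) $$ (r,s)
        = (\<Sum>i\<in>{0..<n}. of_real (d (p i)) * U $$ (r, p i) * cnj (U $$ (s, p i)))"
      using rs sum.permute[OF p', of "\<lambda>i. of_real (d i) * U $$ (r, i) * cnj (U $$ (s, i))"]
      by (simp add: index_rank_one_sum o_def)
    then show "rank_one_sum n {0..<n} d (\<lambda>i r. U $$ (r,i)) $$ (r,s)
        = rank_one_sum n {0..<n} (d \<circ> p) (\<lambda>i r. U' $$ (r,i)) $$ (r,s)"
      using rs by (simp add: index_rank_one_sum U'_def)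
  qed (simp_all add: rank_one_sum_def)
  ultimately show thesis using that p' dec U' by (simp add: diagonalizes_def)
qed

text \<open>\<open>d i\<close> is the value of the quadratic form of \<open>A\<close> at the column
  \<open>i\<close> of \<open>U\<close>, which is nonzero because it has norm 1.\<close>

lemma posdef_eigenvalues_pos:
  assumes A: "posdef_mat n A" and D: "diagonalizes n A U d" and i: "i < n"
  shows "0 < d i"
proof -
  have U: "U \<in> carrier_mat n n"
      and UU: "mat_adjoint U * U = 1\<^sub>m n" using D by (simp_all add: diagonalizes_def)
  have Ac: "A \<in> carrier_mat n n" using A by (simp add: posdef_mat_def)
  let ?x = "col U i"
  have x: "?x \<in> carrier_vec n" by (rule carrier_vecI) (use U in simp)
  have row: "row (mat_adjoint U) i = conjugate ?x"
    by (rule eq_vecI) (use U i in auto)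
  have "1 = row (mat_adjoint U) i \<bullet> ?x"
    using arg_cong[OF UU, of "\<lambda>M. M $$ (i,i)"] U i by simp
  then have "?x \<noteq> 0\<^sub>v n" using x i U by auto
  then have "0 < Re ((A *\<^sub>v ?x) \<bullet>c ?x)" using A x by (simp add: posdef_mat_def)
  also have "(A *\<^sub>v ?x) \<bullet>c ?x = conjugate ?x \<bullet> (A *\<^sub>v ?x)"
    by (rule comm_scalar_prod[of _ n]) (use x Ac in auto)
  also have "\<dots> = (mat_adjoint U * (A * U)) $$ (i,i)"
    unfolding row[symmetric] col_mult2[OF Ac U i, symmetric] using U Ac i by simp
  also have "mat_adjoint U * (A * U) = real_diag_mat n d"
    using diagonalizes_congruence[OF D] U Ac by (simp add: assoc_mult_mat[of _ n n _ n _ n])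
  finally show ?thesis using i by (simp add: real_diag_mat_def)
qed

section \<open>Eigenvalues and minors of compressions\<close>

text \<open>Nonnegative weights make the matrix positive semidefinite, and a nonvanishing
  determinant excludes the eigenvalue zero.\<close>

lemma rank_one_sum_eigenvalues_pos:
  assumes J: "finite J" and c: "\<And>j. j \<in> J \<Longrightarrow> 0 \<le> c j" and det0: "gram_det n J c v \<noteq> 0"
    and D: "diagonalizes n (rank_one_sum n J c v) U d" and i: "i < n"
  shows "0 < d i"
proof -
  have U: "U \<in> carrier_mat n n" using D by (simp add: diagonalizes_def)
  have "d i \<ge> 0"
  proof -
    define z where "z j p = (\<Sum>r\<in>{0..<n}. cnj (U $$ (r,p)) * v j r)" for j p
    have "rank_one_sum n J c z $$ (i,i) = real_diag_mat n d $$ (i,i)"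
      unfolding z_def using rank_one_sum_congruence[OF U, of J c v] diagonalizes_congruence[OF D] by simp
    then have "complex_of_real (d i) = (\<Sum>j\<in>J. of_real (c j) * z j i * cnj (z j i))"
      using i by (simp add: index_rank_one_sum real_diag_mat_def)
    also have "\<dots> = (\<Sum>j\<in>J. of_real (c j * (cmod (z j i))\<^sup>2))"
      by (simp only: of_real_mult complex_norm_square mult.assoc)
    finally have "d i = (\<Sum>j\<in>J. c j * (cmod (z j i))\<^sup>2)"
      unfolding of_real_sum[symmetric] of_real_eq_iff .
    then show ?thesis using c by (simp add: sum_nonneg)
  qed
  moreover have "d i \<noteq> 0"
  proof
    assume "d i = 0"
    then have "(\<Prod>i\<in>{0..<n}. d i) = 0" using i by auto
    then have "det (real_diag_mat n d) = 0" by (simp add: det_real_diag_mat)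
    moreover have "rank_one_sum n J c v = U * real_diag_mat n d * mat_adjoint U"
      using D mult_diag_adjoint[OF U] by (simp add: diagonalizes_def)
    ultimately have "det (rank_one_sum n J c v) = 0" using U by (simp add: det_mult[of _ n])
    then show False using det_rank_one_sum[OF J, of n c v] det0 by simp
  qed
  ultimately show ?thesis by simp
qed

text \<open>The left side is the determinant of the compression to the first \<open>k\<close>
  columns of \<open>W\<close>. Expanded over the eigenvectors, it is at most the product of the top
  \<open>k\<close> eigenvalues times the minor for unit weights, which belongs to the
  identity.\<close>

lemma gram_det_le_top_eigenvalues:
  assumes J: "finite J" and D: "diagonalizes n (rank_one_sum n J c v) U d"
    and pos: "\<And>i. i < n \<Longrightarrow> 0 < d i" and dec: "\<And>i j. i \<le> j \<Longrightarrow> j < n \<Longrightarrow> d j \<le> d i"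
    and W: "W \<in> carrier_mat n n" "mat_adjoint W * W = 1\<^sub>m n" and k: "k \<le> n"
  shows "gram_det k J c (\<lambda>j p. \<Sum>r\<in>{0..<n}. cnj (W $$ (r,p)) * v j r) \<le> (\<Prod>i\<in>{0..<k}. d i)"
proof -
  define y where "y i p = (\<Sum>r\<in>{0..<n}. cnj (W $$ (r,p)) * U $$ (r,i))" for i p
  have U: "U \<in> carrier_mat n n" and UU: "mat_adjoint U * U = 1\<^sub>m n"
    and H: "rank_one_sum n J c v = rank_one_sum n {0..<n} d (\<lambda>i r. U $$ (r,i))"
    using D by (simp_all add: diagonalizes_def)
  have eq: "gram_det k J c (\<lambda>j p. \<Sum>r\<in>{0..<n}. cnj (W $$ (r,p)) * v j r) = gram_det k {0..<n} d y"
    by (rule gram_det_leading_eq[OF _ k])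
      (use rank_one_sum_congruence[OF W(1), of J c v] rank_one_sum_congruence[OF W(1), of "{0..<n}" d] H J in
        \<open>simp_all add: y_def[abs_def]\<close>)
  \<comment> \<open>Unit weights on an orthonormal basis give the identity, and congruence by the
    unitary \<open>W\<close> fixes it.\<close>
  have "rank_one_sum n {0..<n} (\<lambda>_. 1) (\<lambda>i r. U $$ (r,i)) = 1\<^sub>m n"
    using mult_diag_adjoint[OF U, of "\<lambda>_. 1"] unitary_adjoint_right[OF U UU] U
    by (simp add: real_diag_mat_one)
  then have "rank_one_sum n {0..<n} (\<lambda>_. 1) y = mat_adjoint W * 1\<^sub>m n * W"
    using rank_one_sum_congruence[OF W(1), of "{0..<n}" "\<lambda>_. 1"
        "\<lambda>i r. U $$ (r,i)"] by (simp add: y_def[abs_def])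
  also have "\<dots> = real_diag_mat n (\<lambda>_. 1)"
    unfolding real_diag_mat_one using W by (metis mat_adjoint_carrier right_mult_one_mat)
  finally have "gram_det k {0..<n} (\<lambda>_. 1) y = 1"
    using gram_det_leading_diag[OF _ k, of "{0..<n}" "\<lambda>_. 1" y "\<lambda>_. 1"] by simp
  then show ?thesis
    unfolding eq using gram_det_le_prod_initial[where n = n and d = d and k = k and v = y, OF pos dec] by simp
qed

text \<open>All three matrices are compressed to the span of the first \<open>k\<close> columns of
  \<open>U\<close>. The minor is exact at the mixed point, a lower bound for the eigenvalue products
  at the two ends, and log-convex in between.\<close>

lemma top_eigenvalues_log_convex:
  assumes J: "finite J" and u: "u \<ge> 0" and w: "w \<ge> 0" and uw: "u + w = 1" and k: "k \<le> n"
    and D: "diagonalizes n (rank_one_sum n J (\<lambda>j. exp (u * x j + w * y j)) v) U d"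
    and Da: "diagonalizes n (rank_one_sum n J (\<lambda>j. exp (x j)) v) Ua a"
    and Db: "diagonalizes n (rank_one_sum n J (\<lambda>j. exp (y j)) v) Ub b"
    and pos: "\<And>i. i < n \<Longrightarrow> 0 < d i"
    and posa: "\<And>i. i < n \<Longrightarrow> 0 < a i" and deca: "\<And>i j. i \<le> j \<Longrightarrow> j < n \<Longrightarrow> a j \<le> a i"
    and posb: "\<And>i. i < n \<Longrightarrow> 0 < b i" and decb: "\<And>i j. i \<le> j \<Longrightarrow> j < n \<Longrightarrow> b j \<le> b i"
  shows "(\<Sum>i\<in>{0..<k}. ln (d i)) \<le> (\<Sum>i\<in>{0..<k}. u * ln (a i) + w * ln (b i))"
proof -
  have U: "U \<in> carrier_mat n n"
      "mat_adjoint U * U = 1\<^sub>m n" using D by (simp_all add: diagonalizes_def)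
  define z where "z j p = (\<Sum>r\<in>{0..<n}. cnj (U $$ (r,p)) * v j r)" for j p
  let ?g = "\<lambda>l. gram_det k J (\<lambda>j. exp (l j)) z"
  have g: "?g (\<lambda>j. u * x j + w * y j) = (\<Prod>i\<in>{0..<k}. d i)"
    by (rule gram_det_leading_diag[OF _ k J])
      (use rank_one_sum_congruence[OF U(1), of J _ v] diagonalizes_congruence[OF D]
          in \<open>simp add: z_def[abs_def]\<close>)
  have ga: "?g x \<le> (\<Prod>i\<in>{0..<k}. a i)" and gb: "?g y \<le> (\<Prod>i\<in>{0..<k}. b i)"
    using gram_det_le_top_eigenvalues[OF J Da posa deca U k]
      gram_det_le_top_eigenvalues[OF J Db posb decb U k] by (simp_all add: z_def[abs_def])
  have "0 < ?g (\<lambda>j. u * x j + w * y j)" unfolding g using pos k by (intro prod_pos) auto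
  note lc = gram_det_log_convex[OF J u w uw this]
  have ln_prod_k: "ln (\<Prod>i\<in>{0..<k}. f i) = (\<Sum>i\<in>{0..<k}. ln (f i))"
    if "\<And>i. i < n \<Longrightarrow> 0 < f i" for f :: "nat \<Rightarrow> real"
  proof (rule ln_prod)
    fix i assume "i \<in> {0..<k}"
    then show "f i \<noteq> 0" using that[of i] k by simp
  qed simp
  have "(\<Sum>i\<in>{0..<k}. ln (d i)) = ln (?g (\<lambda>j. u * x j + w * y j))"
    using ln_prod_k[of d, OF pos] by (simp add: g)
  also have "\<dots> \<le> u * ln (?g x) + w * ln (?g y)" by (rule lc(3))
  also have "\<dots> \<le> u * ln (\<Prod>i\<in>{0..<k}. a i) + w * ln (\<Prod>i\<in>{0..<k}. b i)"
    using lc(1,2) ga gb u w by (intro add_mono mult_left_mono ln_mono) auto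
  also have "\<dots> = (\<Sum>i\<in>{0..<k}. u * ln (a i) + w * ln (b i))"
    by (simp add: ln_prod_k[of a, OF posa] ln_prod_k[of b, OF posb] sum.distrib sum_distrib_left)
  finally show ?thesis .
qed

section \<open>Strict positivity of the full Gram determinant\<close>

lemma det_nonzero_of_left_inverse:
  fixes A :: "complex mat"
  assumes "A \<in> carrier_mat n n" "B \<in> carrier_mat n n" "B * A = 1\<^sub>m n"
  shows "det A \<noteq> 0" "det B \<noteq> 0"
  using det_mult[OF assms(2,1)] assms(3) by auto

lemma det_adjoint_invertible:
  fixes X :: "complex mat"
  assumes X: "X \<in> carrier_mat n n" "invertible_mat X"
  shows "det (mat_adjoint X) \<noteq> 0"
proof -
  obtain B where B: "X * B = 1\<^sub>m n" "B * X = 1\<^sub>m (dim_row B)"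
    using X unfolding invertible_mat_def inverts_mat_def by auto
  then have "dim_col B = n" "dim_row B = n"
    using X by (metis carrier_matD index_mult_mat(3) index_one_mat(3))+
  then have Bc: "B \<in> carrier_mat n n" by auto
  have one: "mat_adjoint (1\<^sub>m n :: complex mat) = 1\<^sub>m n" by (rule eq_matI) auto
  have "mat_adjoint B * mat_adjoint X = 1\<^sub>m n"
    using mat_adjoint_mult[OF X(1) Bc] B(1) one by simp
  then show ?thesis using det_nonzero_of_left_inverse X Bc by (metis mat_adjoint_carrier)
qed

text \<open>All terms of the expansion are nonnegative, so one selection of linearly independent
  vectors is enough.\<close>

lemma gram_det_pos:
  assumes J: "finite J" and c: "\<And>j. j \<in> J \<Longrightarrow> 0 < c j"
    and h: "\<And>p. p < n \<Longrightarrow> h p \<in> J" and det: "det (mat n n (\<lambda>(p,q). v (h p) q)) \<noteq> 0"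
  shows "0 < gram_det n J c v"
proof -
  let ?t = "\<lambda>f. (\<Prod>p\<in>{0..<n}. c (f p)) * (cmod (det (mat n n (\<lambda>(p,q). v (f p) q))))\<^sup>2"
  let ?F = "PiE {0..<n} (\<lambda>_. J)"
  \<comment> \<open>Members of \<open>PiE\<close> are \<open>undefined\<close> outside the domain,
    so \<open>h\<close> is cut down before it serves as an index of the sum.\<close>
  let ?h = "restrict h {0..<n}"
  have hF: "?h \<in> ?F" using h by auto
  have "mat n n (\<lambda>(p,q). v (?h p) q) = mat n n (\<lambda>(p,q). v (h p) q)" by (rule eq_matI) auto
  then have "0 < ?t ?h" using det c h by (auto intro!: mult_pos_pos prod_pos)
  moreover have "0 \<le> ?t f" if "f \<in> ?F" for f
    using that by (intro mult_nonneg_nonneg prod_nonneg) (auto intro!: less_imp_le[OF c] simp: PiE_iff)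
  moreover have "finite ?F" by (rule finite_PiE) (use J in auto)
  ultimately have "0 < sum ?t ?F" using hF by (intro sum_pos2[of ?F ?h]) auto
  then show ?thesis by (simp add: gram_det_def)
qed

section \<open>Joint convexity of the trace function\<close>

theorem theorem1p1:
  fixes \<phi> :: "real \<Rightarrow> real"
    and n :: nat
    and A X :: "'m::finite \<Rightarrow> complex mat"
  assumes mono: "mono_on {0<..} \<phi>"
    and conv: "convex_on UNIV (\<lambda>t. \<phi> (exp t))"
    and A: "\<And>i. posdef_mat n (A i)"
    and X: "\<And>i. X i \<in> carrier_mat n n \<and> invertible_mat (X i)"
  shows "convex_on UNIV
           (\<lambda>t :: real ^ 'm. Re (mat_trace (mat_fun \<phi>
              (mat_sum n (\<lambda>i. mat_adjoint (X i) * mat_powr (A i) (t $ i) * X i) UNIV))))"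
proof -
  have "\<exists>U d. diagonalizes n (A i) U d \<and> (\<forall>f. mat_fun f (A i)
      = rank_one_sum n {0..<n} (\<lambda>p. f (d p)) (\<lambda>p r. U $$ (r,p)))" for i
    using diagonalizes_mat_fun[of "A i" n] A[of i] unfolding posdef_mat_def hermitian_mat_def by metis
  then obtain U d where D: "\<And>i. diagonalizes n (A i) (U i) (d i)"
    and fA: "\<And>i f. mat_fun f (A i) = rank_one_sum n {0..<n} (\<lambda>p. f (d i p)) (\<lambda>p r. U i $$ (r,p))"
    by metis
  have dpos: "0 < d i p" if "p < n" for i p using posdef_eigenvalues_pos[OF A D that] .
  \<comment> \<open>\<open>(i,p)\<close> stands for the eigenvector \<open>p\<close> of
    \<open>A i\<close>; \<open>V (i,p)\<close> is its image under the adjoint of \<open>X i\<close>,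
    and \<open>l t (i,p)\<close>, the logarithm of its weight, is linear in
    \<open>t\<close>.\<close>
  define J where "J = (UNIV :: 'm set) \<times> {0..<n}"
  define V where "V = (\<lambda>(i,p) q. \<Sum>r\<in>{0..<n}. cnj (X i $$ (r,q)) * U i $$ (r,p))"
  define l where "l t = (\<lambda>(i,p). (t $ i) * ln (d i p))" for t :: "real ^ 'm"
  define H where "H t = mat_sum n (\<lambda>i. mat_adjoint (X i) * mat_powr (A i) (t $ i) * X i) UNIV"
      for t :: "real ^ 'm"
  have Xc: "X i \<in> carrier_mat n n" for i using X by blast
  have J: "finite J" by (simp add: J_def)
  have H: "H t = rank_one_sum n J (\<lambda>j. exp (l t j)) V" for t
  proof (rule eq_matI)
    fix r s assume "r < dim_row (rank_one_sum n J (\<lambda>j. exp (l t j)) V)"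
        "s < dim_col (rank_one_sum n J (\<lambda>j. exp (l t j)) V)"
    then have rs: "r < n" "s < n" by (simp_all add: rank_one_sum_def)
    have "H t $$ (r,s)
        = (\<Sum>i\<in>UNIV. rank_one_sum n {0..<n} (\<lambda>p. d i p powr (t $ i)) (\<lambda>p. V (i,p)) $$ (r,s))"
      using rs by (simp add: H_def mat_sum_def mat_powr_def fA V_def rank_one_sum_congruence[OF Xc])
    \<comment> \<open>Rewriting \<open>powr\<close> as an exponential requires a nonzero base, here
      a positive eigenvalue of \<open>A i\<close>.\<close>
    also have "\<dots> = (\<Sum>i\<in>UNIV. \<Sum>p\<in>{0..<n}. of_real (exp (l t (i,p))) * V (i,p) r * cnj (V (i,p) s))"
      using rs by (auto simp: index_rank_one_sum l_def powr_def less_imp_neq[OF dpos, symmetric] intro!: sum.cong)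
    also have "\<dots> = rank_one_sum n J (\<lambda>j. exp (l t j)) V $$ (r,s)"
      using rs by (simp add: index_rank_one_sum J_def sum.cartesian_product case_prod_unfold)
    finally show "H t $$ (r,s) = rank_one_sum n J (\<lambda>j. exp (l t j)) V $$ (r,s)" .
  qed (simp_all add: H_def mat_sum_def rank_one_sum_def)
  have gpos: "0 < gram_det n J (\<lambda>j. exp (l t j)) V" for t
  proof -
    \<comment> \<open>An arbitrary index will do: the eigenvectors of a single \<open>A i\<close>,
      mapped by the invertible adjoint of \<open>X i\<close>, are already linearly
      independent.\<close>
    let ?i = "undefined :: 'm"
    have U: "U ?i \<in> carrier_mat n n" "mat_adjoint (U ?i) * U ?i = 1\<^sub>m n"
      using D[of ?i] by (simp_all add: diagonalizes_def)
    have Xi: "X ?i \<in> carrier_mat n n" "invertible_mat (X ?i)" using X[of ?i] by auto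
    let ?M = "mat n n (\<lambda>(p,q). V (?i,p) q)"
    have "?M = transpose_mat (mat_adjoint (X ?i) * U ?i)"
      by (rule eq_matI)
          (use U Xi in \<open>auto simp: V_def index_mult_mat_sum simp del: index_mult_mat(1)\<close>)
    then have "det ?M = det (mat_adjoint (X ?i) * U ?i)"
      using U Xi by (simp add: det_transpose[of _ n] mult_carrier_mat[of _ n n])
    also have "\<dots> = det (mat_adjoint (X ?i)) * det (U ?i)"
      using U Xi by (intro det_mult[of _ n]) auto
    finally have "det ?M \<noteq> 0"
      using det_adjoint_invertible[OF Xi] det_nonzero_of_left_inverse(1)[OF U(1) mat_adjoint_carrier[OF U(1)] U(2)]
      by simp
    then show ?thesis by (intro gram_det_pos[where h = "Pair ?i"]) (auto simp: J_def)
  qed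
  \<comment> \<open>The eigenvalues are recorded in decreasing order, and the trace is written with
    \<open>exp (ln (b i))\<close> so that the convex function
    \<open>\<lambda>s. \<phi> (exp s)\<close> appears.\<close>
  have "\<exists>W b. diagonalizes n (H t) W b \<and> (\<forall>i<n. 0 < b i) \<and> (\<forall>i j. i \<le> j \<longrightarrow> j < n \<longrightarrow> b j \<le> b i)
      \<and> Re (mat_trace (mat_fun \<phi> (H t))) = (\<Sum>i\<in>{0..<n}. \<phi> (exp (ln (b i))))" for t
  proof -
    have "H t \<in> carrier_mat n n" "mat_adjoint (H t) = H t"
      by (simp_all add: H mat_adjoint_rank_one_sum)
    from diagonalizes_mat_fun[OF this] obtain W b where W: "diagonalizes n (H t) W b"
      and fH: "\<And>f. mat_fun f (H t)
          = rank_one_sum n {0..<n} (\<lambda>i. f (b i)) (\<lambda>i r. W $$ (r,i))" by blast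
    have tr: "Re (mat_trace (mat_fun \<phi> (H t))) = (\<Sum>i\<in>{0..<n}. \<phi> (b i))"
      unfolding fH using trace_diagonalized[of W n "\<lambda>i. \<phi> (b i)"] W by (simp add: diagonalizes_def)
    obtain p W' where p: "p permutes {0..<n}" and W': "diagonalizes n (H t) W' (b \<circ> p)"
      and dec: "\<And>i j. i \<le> j \<Longrightarrow> j < n \<Longrightarrow> b (p j) \<le> b (p i)"
      using diagonalizes_sorted[OF W] by blast
    have pos: "0 < (b \<circ> p) i" if "i < n" for i
      by (rule rank_one_sum_eigenvalues_pos[OF J _ _ W'[unfolded H] that]) (use gpos[of t] in auto)
    have "(\<Sum>i\<in>{0..<n}. \<phi> (b i)) = (\<Sum>i\<in>{0..<n}. \<phi> (exp (ln ((b \<circ> p) i))))"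
      using sum.permute[OF p, of "\<lambda>i. \<phi> (b i)"] pos by (simp add: o_def)
    with W' dec pos tr show ?thesis by (intro exI[of _ W'] exI[of _ "b \<circ> p"]) auto
  qed
  then have "\<forall>t. \<exists>W b. diagonalizes n (H t) W b \<and> (\<forall>i<n. 0 < b i) \<and> (\<forall>i j. i \<le> j \<longrightarrow> j < n \<longrightarrow> b j \<le> b i)
      \<and> Re (mat_trace (mat_fun \<phi> (H t))) = (\<Sum>i\<in>{0..<n}. \<phi> (exp (ln (b i))))" by (rule allI)
  then obtain W b where "\<forall>t. diagonalizes n (H t) (W t) (b t) \<and> (\<forall>i<n. 0 < b t i)
      \<and> (\<forall>i j. i \<le> j \<longrightarrow> j < n \<longrightarrow> b t j \<le> b t i)
      \<and> Re (mat_trace (mat_fun \<phi> (H t))) = (\<Sum>i\<in>{0..<n}. \<phi> (exp (ln (b t i))))"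
    unfolding choice_iff by (elim exE)
  then have W: "\<And>t. diagonalizes n (H t) (W t) (b t)" and bpos: "\<And>t i. i < n \<Longrightarrow> 0 < b t i"
    and bdec: "\<And>t i j. i \<le> j \<Longrightarrow> j < n \<Longrightarrow> b t j \<le> b t i"
    and tr: "\<And>t. Re (mat_trace (mat_fun \<phi> (H t))) = (\<Sum>i\<in>{0..<n}. \<phi> (exp (ln (b t i))))"
    by simp_all
  have mono': "mono (\<lambda>t. \<phi> (exp t))"
    by (rule monoI) (use mono in \<open>auto simp: mono_on_def\<close>)
  have "Re (mat_trace (mat_fun \<phi> (H (u *\<^sub>R x + w *\<^sub>R y)))) \<le>
      u * Re (mat_trace (mat_fun \<phi> (H x))) + w * Re (mat_trace (mat_fun \<phi> (H y)))"
    if u: "0 \<le> u" and w: "0 \<le> w" and uw: "u + w = 1" for u w and x y :: "real ^ 'm"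
  proof -
    have lin: "l (u *\<^sub>R x + w *\<^sub>R y) = (\<lambda>j. u * l x j + w * l y j)"
      by (auto simp: l_def algebra_simps)
    let ?z = "u *\<^sub>R x + w *\<^sub>R y"
    \<comment> \<open>The logarithms at the mixed point are weakly majorized by the combination that
      pairs the eigenvalues of equal rank at \<open>x\<close> and \<open>y\<close>.\<close>
    have "(\<Sum>i\<in>{0..<n}. \<phi> (exp (ln (b ?z i))))
        \<le> (\<Sum>i\<in>{0..<n}. \<phi> (exp (u * ln (b x i) + w * ln (b y i))))"
    proof (rule weak_majorization_sum_le[OF conv mono'])
      show "ln (b ?z j) \<le> ln (b ?z i)" if "i \<le> j" "j < n" for i j
        using bpos[of j ?z] bpos[of i ?z] bdec[OF that, of ?z] that by simp
      show "(\<Sum>i\<in>{0..<k}. ln (b ?z i)) \<le> (\<Sum>i\<in>{0..<k}. u * ln (b x i) + w * ln (b y i))"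
          if "k \<le> n" for k
        by (rule top_eigenvalues_log_convex[OF J u w uw that W[of ?z, unfolded H lin] W[of x, unfolded H]
            W[of y, unfolded H] bpos bpos bdec bpos bdec])
    qed
    \<comment> \<open>Convexity enters a second time, now separately for each rank
      \<open>i\<close>.\<close>
    also have "\<dots> \<le> (\<Sum>i\<in>{0..<n}. u * \<phi> (exp (ln (b x i))) + w * \<phi> (exp (ln (b y i))))"
    proof (rule sum_mono)
      fix i
      show "\<phi> (exp (u * ln (b x i) + w * ln (b y i)))
          \<le> u * \<phi> (exp (ln (b x i))) + w * \<phi> (exp (ln (b y i)))"
        using conv u w uw unfolding convex_on_def by auto
    qed
    finally show ?thesis
      unfolding tr by (simp add: sum.distrib sum_distrib_left)
  qed
  then have "convex_on UNIV (\<lambda>t. Re (mat_trace (mat_fun \<phi> (H t))))"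
    by (auto simp: convex_on_def)
  then show ?thesis unfolding H_def .
qed

end
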